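(* Let $p$ be a real number with $0\le p\le 10^{-46}$. Let $m$ be a positive integer, let $w\in\mathbb{R}_{>0}^m$ satisfy $\sum_{i=1}^m w_i=1$, and let $v=(v_1,\dots,v_m)\in\{0,1\}^m$ be a random vector with i.i.d. Bernoulli$(p)$ coordinates. Then \[\mathbb{P}[\langle v,w\rangle\ge p]\ge p.\]
   Context: Here $\langle v,w\rangle=\sum_{i=1}^m w_iv_i$, and Bernoulli$(p)$ means taking value $1$ with probability $p$ and value $0$ with probability $1-p$. *)

theory Defs
  imports "HOL-Probability.Probability"
begin

definition (in prob_space) bernoulli_rv :: "real \<Rightarrow> ('a \<Rightarrow> real) \<Rightarrow> bool" where
  "bernoulli_rv p X \<longleftrightarrow>
     random_variable borel X \<and>
     prob {\<omega> \<in> space M. X \<omega> = 1} = p \<and>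
     prob {\<omega> \<in> space M. X \<omega> = 0} = 1 - p"

end

(* Let Y be the weighted sum, A the largest weight, s^2 = p * (sum of squared weights), with p tiny.
   If s >= A / 100, tilting the coordinate probabilities in proportion to the weights moves the mean
   of Y up by about s at chi-square cost O(1), so P[Y >= E Y] is bounded below by a constant.
   Otherwise, let the coordinate of a largest weight be 1: by Chebyshev the rest very likely
   compensates for the missing mass. If a second weight is at least A / 20, either of the two large
   coordinates may be used, which yields almost 2p. In the remaining case write Y' for the sum
   without the largest weight; one has to show p P[Y' < E Y - A] <= (1 - p) P[Y' >= E Y]. A tilt of
   the i-th probability by about x_i = min(1, k a_i), with k chosen so that the mean moves by about
   A / 4, gives P[Y' >= E Y] >= exp(- k A / (4 p)) / 4, while Chernoff's bound with parameter 2 k / p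
   gives P[Y' < E Y - A] <= exp(- k A / (4 p)). *)
theory Submission
  imports Defs
begin

section \<open>Product measures on the cube: expectations and the first two moments\<close>

text \<open>A point of the cube is encoded as the set of its coordinates equal to 1.\<close>
definition cube_exp :: "'i set \<Rightarrow> ('i \<Rightarrow> real) \<Rightarrow> ('i set \<Rightarrow> real) \<Rightarrow> real" where
  "cube_exp I q f = (\<Sum>S\<in>Pow I. (\<Prod>i\<in>S. q i) * (\<Prod>i\<in>I - S. 1 - q i) * f S)"

definition cube_tail :: "'i set \<Rightarrow> ('i \<Rightarrow> real) \<Rightarrow> ('i \<Rightarrow> real) \<Rightarrow> real \<Rightarrow> real" where
  "cube_tail I q a t = cube_exp I q (\<lambda>S. of_bool (t \<le> sum a S))"

lemma cube_weight_nonneg: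
  assumes "\<And>i. i \<in> I \<Longrightarrow> 0 \<le> q i \<and> q i \<le> (1::real)" "S \<in> Pow I"
  shows "0 \<le> (\<Prod>i\<in>S. q i) * (\<Prod>i\<in>I - S. 1 - q i)"
  using assms by (intro mult_nonneg_nonneg prod_nonneg) auto

lemma cube_exp_mono:
  assumes "\<And>i. i \<in> I \<Longrightarrow> 0 \<le> q i \<and> q i \<le> 1" "\<And>S. S \<subseteq> I \<Longrightarrow> f S \<le> g S"
  shows "cube_exp I q f \<le> cube_exp I q g"
  unfolding cube_exp_def
  using assms by (intro sum_mono mult_left_mono cube_weight_nonneg) auto

lemma cube_exp_cmult: "cube_exp I q (\<lambda>S. c * f S) = c * cube_exp I q f"
  by (simp add: cube_exp_def sum_distrib_left algebra_simps)

lemma cube_exp_diff: "cube_exp I q (\<lambda>S. f S - g S) = cube_exp I q f - cube_exp I q g"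
  by (simp add: cube_exp_def right_diff_distrib sum_subtractf)

text \<open>Expanding the product over \<open>I\<close> chooses one of two summands for each
  coordinate, that is, a subset \<open>S\<close>. The case \<open>f i = 1\<close> gives total mass
  1, and \<open>f i = exp (- s * a i)\<close> gives the Laplace transform behind Chernoff's
  bound.\<close>

lemma cube_exp_prod:
  assumes "finite I"
  shows "cube_exp I q (\<lambda>S. \<Prod>i\<in>S. f i) = (\<Prod>i\<in>I. q i * f i + (1 - q i))"
  by (simp add: cube_exp_def prod_add[OF assms] prod.distrib mult_ac)

lemma cube_exp_const:
  assumes "finite I"
  shows "cube_exp I q (\<lambda>S. c) = c"
  using cube_exp_prod[OF assms, of q "\<lambda>_. 1"] cube_exp_cmult[of I q c "\<lambda>_. 1"] by simp

text \<open>Conditioning on coordinate \<open>k\<close>: a subset of \<open>insert k I\<close>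
  either avoids \<open>k\<close> or is \<open>insert k S\<close> with \<open>S\<close> avoiding it.
  This drives the moment inductions and, later, the separation of the largest weights.\<close>

lemma cube_exp_insert:
  assumes "finite I" "k \<notin> I"
  shows "cube_exp (insert k I) q f =
    q k * cube_exp I q (\<lambda>S. f (insert k S)) + (1 - q k) * cube_exp I q f"
proof -
  let ?t = "\<lambda>S. (\<Prod>i\<in>S. q i) * (\<Prod>i\<in>insert k I - S. 1 - q i) * f S"
  have "cube_exp (insert k I) q f = sum ?t (Pow I) + sum ?t (insert k ` Pow I)"
    unfolding cube_exp_def Pow_insert using assms by (intro sum.union_disjoint) auto
  also have "sum ?t (Pow I) = (\<Sum>S\<in>Pow I. (1 - q k) * ((\<Prod>i\<in>S. q i) * (\<Prod>i\<in>I - S. 1 - q i) * f S))"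
  proof (rule sum.cong, goal_cases)
    case (2 S)
    then have "insert k I - S = insert k (I - S)" using assms by auto
    then show ?case using assms by simp
  qed simp
  also have "sum ?t (insert k ` Pow I) = (\<Sum>S\<in>Pow I. ?t (insert k S))"
    using assms by (intro sum.reindex_cong[of "insert k"]) (auto simp: inj_on_def)
  also have "\<dots> = (\<Sum>S\<in>Pow I. q k * ((\<Prod>i\<in>S. q i) * (\<Prod>i\<in>I - S. 1 - q i) * f (insert k S)))"
  proof (rule sum.cong, goal_cases)
    case (2 S)
    then have "insert k I - insert k S = I - S" "finite S" "k \<notin> S"
      using assms finite_subset by auto
    then show ?case by simp
  qed simp
  finally show ?thesis by (simp add: cube_exp_def sum_distrib_left)
qed

lemma cube_exp_sum_diff:
  assumes "finite I"
  shows "cube_exp I q (\<lambda>S. sum a S - t) = (\<Sum>i\<in>I. q i * a i) - t"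
  using assms
\<comment> \<open>The centre \<open>t\<close> must vary, since coordinate \<open>k\<close> being 1
  replaces it by \<open>t - a k\<close>.\<close>
proof (induction arbitrary: t)
  case empty
  then show ?case by (simp add: cube_exp_def)
next
  case (insert k I)
  have *: "cube_exp I q (\<lambda>S. sum a (insert k S) - t) = cube_exp I q (\<lambda>S. sum a S - (t - a k))"
    unfolding cube_exp_def
  proof (rule sum.cong, goal_cases)
    case (2 S)
    then have "finite S" "k \<notin> S" using insert finite_subset by auto
    then have "sum a (insert k S) - t = sum a S - (t - a k)" by simp
    then show ?case by (simp only:)
  qed simp
  show ?case
    by (simp only: cube_exp_insert[OF insert.hyps] * insert.IH sum.insert[OF insert.hyps])
      (simp add: algebra_simps)
qed

text \<open>Squared bias plus variance; the variances of independent coordinates add up.\<close>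

lemma cube_exp_sum_diff_square:
  assumes "finite I"
  shows "cube_exp I q (\<lambda>S. (sum a S - t)\<^sup>2) =
    ((\<Sum>i\<in>I. q i * a i) - t)\<^sup>2 + (\<Sum>i\<in>I. (a i)\<^sup>2 * (q i * (1 - q i)))"
  using assms
proof (induction arbitrary: t)
  case empty
  then show ?case by (simp add: cube_exp_def)
next
  case (insert k I)
  have *: "cube_exp I q (\<lambda>S. (sum a (insert k S) - t)\<^sup>2) = cube_exp I q (\<lambda>S. (sum a S - (t - a k))\<^sup>2)"
    unfolding cube_exp_def
  proof (rule sum.cong, goal_cases)
    case (2 S)
    then have "finite S" "k \<notin> S" using insert finite_subset by auto
    then have "sum a (insert k S) - t = sum a S - (t - a k)" by simp
    then show ?case by (simp only:)
  qed simp
  define m V where "m = (\<Sum>i\<in>I. q i * a i)" and "V = (\<Sum>i\<in>I. (a i)\<^sup>2 * (q i * (1 - q i)))"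
  show ?case
    by (simp only: cube_exp_insert[OF insert.hyps] * insert.IH sum.insert[OF insert.hyps]
        m_def[symmetric] V_def[symmetric]) (simp add: power2_eq_square algebra_simps)
qed

lemma cube_tail_insert:
  assumes "finite I" "k \<notin> I"
  shows "cube_tail (insert k I) q a t = q k * cube_tail I q a (t - a k) + (1 - q k) * cube_tail I q a t"
proof -
  have "cube_exp I q (\<lambda>S. of_bool (t \<le> sum a (insert k S))) = cube_tail I q a (t - a k)"
    unfolding cube_exp_def cube_tail_def
  proof (rule sum.cong, goal_cases)
    case (2 S)
    then have "finite S" "k \<notin> S" using assms finite_subset by auto
    then show ?case by (simp add: algebra_simps)
  qed simp
  then show ?thesis using assms by (simp add: cube_exp_insert cube_tail_def)
qed

lemma cube_tail_nonneg:
  assumes "\<And>i. i \<in> I \<Longrightarrow> 0 \<le> q i \<and> q i \<le> 1"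
  shows "0 \<le> cube_tail I q a t"
  unfolding cube_tail_def cube_exp_def
  using assms by (intro sum_nonneg mult_nonneg_nonneg[OF cube_weight_nonneg]) auto

section \<open>Tail bounds: second moment, Chebyshev, change of measure, Chernoff\<close>

lemma weighted_Cauchy_Schwarz_sum:
  fixes w f g :: "'i \<Rightarrow> real"
  assumes "\<And>i. i \<in> A \<Longrightarrow> 0 \<le> w i"
  shows "(\<Sum>i\<in>A. w i * (f i * g i))\<^sup>2 \<le> (\<Sum>i\<in>A. w i * (f i)\<^sup>2) * (\<Sum>i\<in>A. w i * (g i)\<^sup>2)"
proof -
  have "(\<Sum>i\<in>A. w i * (f i * g i)) = (\<Sum>i\<in>A. (sqrt (w i) * f i) * (sqrt (w i) * g i))"
    using assms by (intro sum.cong) (auto simp: mult_ac)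
  then have "(\<Sum>i\<in>A. w i * (f i * g i))\<^sup>2 \<le>
      (\<Sum>i\<in>A. (sqrt (w i) * f i)\<^sup>2) * (\<Sum>i\<in>A. (sqrt (w i) * g i)\<^sup>2)"
    by (metis Cauchy_Schwarz_ineq_sum)
  also have "(\<Sum>i\<in>A. (sqrt (w i) * f i)\<^sup>2) = (\<Sum>i\<in>A. w i * (f i)\<^sup>2)"
    using assms by (intro sum.cong) (auto simp: power_mult_distrib)
  also have "(\<Sum>i\<in>A. (sqrt (w i) * g i)\<^sup>2) = (\<Sum>i\<in>A. w i * (g i)\<^sup>2)"
    using assms by (intro sum.cong) (auto simp: power_mult_distrib)
  finally show ?thesis .
qed

text \<open>Cantelli's inequality. With Y the weighted sum, E[Y - t] is at most
  E[(Y - t) 1{Y \<ge> t}], and Cauchy-Schwarz bounds the square of the latter by E[(Y - t)^2]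
  P[Y \<ge> t].\<close>

lemma cube_tail_second_moment:
  assumes fin: "finite I" and q: "\<And>i. i \<in> I \<Longrightarrow> 0 \<le> q i \<and> q i \<le> 1"
    and mu: "0 < m" "m \<le> (\<Sum>i\<in>I. q i * a i) - t"
    and V: "(\<Sum>i\<in>I. (a i)\<^sup>2 * (q i * (1 - q i))) \<le> V"
  shows "m\<^sup>2 / (m\<^sup>2 + V) \<le> cube_tail I q a t"
proof -
  define n where "n = (\<Sum>i\<in>I. q i * a i) - t"
  define W where "W = (\<Sum>i\<in>I. (a i)\<^sup>2 * (q i * (1 - q i)))"
  have W0: "0 \<le> W" unfolding W_def using q by (intro sum_nonneg) auto
  have n: "0 < n" "m \<le> n" using mu by (auto simp: n_def)
  have "n = cube_exp I q (\<lambda>S. sum a S - t)"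
    using fin by (simp add: cube_exp_sum_diff n_def)
  also have "\<dots> \<le> cube_exp I q (\<lambda>S. (sum a S - t) * of_bool (t \<le> sum a S))"
    using q by (intro cube_exp_mono) auto
  finally have "n\<^sup>2 \<le> (cube_exp I q (\<lambda>S. (sum a S - t) * of_bool (t \<le> sum a S)))\<^sup>2"
    using n by (intro power_mono) auto
  also have "\<dots> \<le> cube_exp I q (\<lambda>S. (sum a S - t)\<^sup>2) * cube_exp I q (\<lambda>S. (of_bool (t \<le> sum a S))\<^sup>2)"
    unfolding cube_exp_def using q by (intro weighted_Cauchy_Schwarz_sum cube_weight_nonneg)
  also have "\<dots> = (n\<^sup>2 + W) * cube_tail I q a t"
  proof -
    have "(of_bool b)\<^sup>2 = (of_bool b :: real)" for b by simp
    then show ?thesis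
      by (simp only: cube_exp_sum_diff_square[OF fin] n_def W_def cube_tail_def)
  qed
  finally have "n\<^sup>2 / (n\<^sup>2 + W) \<le> cube_tail I q a t"
    using n W0 by (simp add: divide_le_eq add_pos_nonneg mult_ac)
  \<comment> \<open>The quotient grows with the mean gap and decreases with the variance, so the
    bounds \<open>m\<close> and \<open>V\<close> may replace the exact values.\<close>
  moreover have "m\<^sup>2 / (m\<^sup>2 + V) \<le> n\<^sup>2 / (n\<^sup>2 + W)"
  proof -
    have WV: "W \<le> V" using V by (simp add: W_def)
    have "m\<^sup>2 \<le> n\<^sup>2" using mu n by (auto intro: power_mono)
    then have "m\<^sup>2 * W \<le> n\<^sup>2 * V" using WV W0 by (intro mult_mono) auto
    then have "m\<^sup>2 * (n\<^sup>2 + W) \<le> n\<^sup>2 * (m\<^sup>2 + V)" by (simp add: algebra_simps)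
    moreover have "0 < m\<^sup>2 + V" "0 < n\<^sup>2 + W" using mu n W0 WV by (simp_all add: add_pos_nonneg)
    ultimately show ?thesis
      by (simp only: pos_divide_le_eq times_divide_eq_left pos_le_divide_eq)
  qed
  ultimately show ?thesis by linarith
qed

text \<open>A weakening of the previous bound, since (m^2 - V)(m^2 + V) \<le> m^4; this form is
  convenient when the tail should be close to 1.\<close>

lemma cube_tail_Chebyshev:
  assumes fin: "finite I" and q: "\<And>i. i \<in> I \<Longrightarrow> 0 \<le> q i \<and> q i \<le> 1"
    and mu: "0 < m" "m \<le> (\<Sum>i\<in>I. q i * a i) - t"
    and V: "(\<Sum>i\<in>I. (a i)\<^sup>2 * (q i * (1 - q i))) \<le> V"
  shows "1 - V / m\<^sup>2 \<le> cube_tail I q a t"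
proof -
  have V0: "0 \<le> V" using V q by (intro order_trans[OF sum_nonneg V]) auto
  have m2: "0 < m\<^sup>2" using mu by simp
  have "(m\<^sup>2 - V) * (m\<^sup>2 + V) \<le> m\<^sup>2 * m\<^sup>2"
    using zero_le_power2[of V] by (simp add: algebra_simps power2_eq_square)
  then have "(m\<^sup>2 - V) / m\<^sup>2 \<le> m\<^sup>2 / (m\<^sup>2 + V)"
    using m2 V0 by (simp add: pos_divide_le_eq pos_le_divide_eq add_pos_nonneg)
  moreover have "1 - V / m\<^sup>2 = (m\<^sup>2 - V) / m\<^sup>2"
    using m2 by (simp add: diff_divide_distrib)
  ultimately have "1 - V / m\<^sup>2 \<le> m\<^sup>2 / (m\<^sup>2 + V)" by simp
  also have "\<dots> \<le> cube_tail I q a t"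
    using assms by (rule cube_tail_second_moment)
  finally show ?thesis .
qed

text \<open>Cauchy-Schwarz with the likelihood ratio \<open>wq S / wp S\<close>: the squared tilted
  probability is at most the second moment of the ratio times the original probability. That second
  moment factorises over the coordinates.\<close>

lemma cube_tail_change_measure:
  assumes fin: "finite I" and p: "0 < p" "p < 1"
    and x: "\<And>i. i \<in> I \<Longrightarrow> 0 \<le> x i \<and> x i \<le> 1"
  shows "(cube_tail I (\<lambda>i. p + (1 - p) * x i) a t)\<^sup>2 * exp (- (\<Sum>i\<in>I. (x i)\<^sup>2) / p)
      \<le> cube_tail I (\<lambda>_. p) a t"
proof -
  define q where "q = (\<lambda>i. p + (1 - p) * x i)"
  define wp where "wp S = (\<Prod>i\<in>S. p) * (\<Prod>i\<in>I - S. 1 - p)" for S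
  define wq where "wq S = (\<Prod>i\<in>S. q i) * (\<Prod>i\<in>I - S. 1 - q i)" for S
  have wp: "0 < wp S" for S
    unfolding wp_def using p by (intro mult_pos_pos prod_pos) auto
  have ratio: "wp S * (wq S / wp S)\<^sup>2 = (\<Prod>i\<in>S. (q i)\<^sup>2 / p) * (\<Prod>i\<in>I - S. (1 - q i)\<^sup>2 / (1 - p))" for S
  proof -
    have "wp S * (wq S / wp S)\<^sup>2 = (wq S)\<^sup>2 / wp S"
      using wp[of S] by (simp add: power2_eq_square)
    then show ?thesis
      by (simp add: wq_def wp_def prod_dividef power_mult_distrib prod_power_distrib)
  qed
  \<comment> \<open>Each factor is 1 plus the chi-square divergence of two Bernoulli laws; the
    parametrisation \<open>p + (1 - p) * x i\<close> makes it 1 + (1 - p) x_i^2 / p.\<close>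
  have factor: "(q i)\<^sup>2 / p + (1 - q i)\<^sup>2 / (1 - p) \<le> exp ((x i)\<^sup>2 / p)" for i
  proof -
    have "(q i)\<^sup>2 / p + (1 - q i)\<^sup>2 / (1 - p) = 1 + (1 - p) * (x i)\<^sup>2 / p"
      using p by (simp add: q_def field_simps power2_eq_square)
    also have "\<dots> \<le> 1 + (x i)\<^sup>2 / p"
      using p by (simp add: field_simps)
    also have "\<dots> \<le> exp ((x i)\<^sup>2 / p)" by (rule exp_ge_add_one_self)
    finally show ?thesis .
  qed
  have "cube_tail I q a t = (\<Sum>S\<in>Pow I. wp S * (wq S / wp S * of_bool (t \<le> sum a S)))"
    unfolding cube_tail_def cube_exp_def
    using wp by (intro sum.cong) (auto simp: wq_def less_imp_neq[symmetric])
  then have "(cube_tail I q a t)\<^sup>2 \<le> (\<Sum>S\<in>Pow I. wp S * (wq S / wp S)\<^sup>2) *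
      (\<Sum>S\<in>Pow I. wp S * (of_bool (t \<le> sum a S))\<^sup>2)"
    using wp by (simp only:) (intro weighted_Cauchy_Schwarz_sum, auto intro: less_imp_le)
  also have "(\<Sum>S\<in>Pow I. wp S * (of_bool (t \<le> sum a S))\<^sup>2) = cube_tail I (\<lambda>_. p) a t"
    unfolding cube_tail_def cube_exp_def wp_def by (intro sum.cong) auto
  also have "(\<Sum>S\<in>Pow I. wp S * (wq S / wp S)\<^sup>2) = (\<Prod>i\<in>I. (q i)\<^sup>2 / p + (1 - q i)\<^sup>2 / (1 - p))"
    by (simp add: ratio prod_add[OF fin])
  also have "\<dots> * cube_tail I (\<lambda>_. p) a t \<le> (\<Prod>i\<in>I. exp ((x i)\<^sup>2 / p)) * cube_tail I (\<lambda>_. p) a t"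
    using p factor by (intro mult_right_mono prod_mono cube_tail_nonneg conjI add_nonneg_nonneg) auto
  also have "(\<Prod>i\<in>I. exp ((x i)\<^sup>2 / p)) = exp ((\<Sum>i\<in>I. (x i)\<^sup>2) / p)"
    by (simp add: exp_sum[OF fin] sum_divide_distrib)
  finally show ?thesis
    by (simp add: q_def exp_minus field_simps)
qed

text \<open>A bound for the lower tail: the indicator of \<open>sum a S < t\<close> is at most
  \<open>exp (s * (t - sum a S))\<close>, whose expectation is a product, and 1 + y \<le> exp y is
  applied to each factor.\<close>

lemma cube_tail_Chernoff:
  assumes fin: "finite I" and p: "0 \<le> p" "p \<le> 1" and s: "0 \<le> s"
  shows "1 - cube_tail I (\<lambda>_. p) a t \<le> exp (s * t + (\<Sum>i\<in>I. p * (exp (- s * a i) - 1)))"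
proof -
  have "1 - cube_tail I (\<lambda>_. p) a t = cube_exp I (\<lambda>_. p) (\<lambda>S. 1 - of_bool (t \<le> sum a S))"
    using fin by (simp add: cube_exp_diff cube_exp_const cube_tail_def)
  also have "\<dots> \<le> cube_exp I (\<lambda>_. p) (\<lambda>S. exp (s * t) * (\<Prod>i\<in>S. exp (- s * a i)))"
  proof (rule cube_exp_mono)
    fix S assume "S \<subseteq> I"
    then have "finite S" using fin finite_subset by auto
    then have *: "exp (s * t) * (\<Prod>i\<in>S. exp (- s * a i)) = exp (s * (t - sum a S))"
      by (simp add: exp_sum[symmetric] sum_distrib_left[symmetric] sum_negf exp_add[symmetric] algebra_simps)
    show "1 - of_bool (t \<le> sum a S) \<le> exp (s * t) * (\<Prod>i\<in>S. exp (- s * a i))"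
      unfolding * using s by auto
  qed (use p in auto)
  also have "\<dots> = exp (s * t) * (\<Prod>i\<in>I. p * exp (- s * a i) + (1 - p))"
    using fin by (simp add: cube_exp_cmult cube_exp_prod)
  also have "\<dots> \<le> exp (s * t) * (\<Prod>i\<in>I. exp (p * (exp (- s * a i) - 1)))"
  proof (intro mult_left_mono prod_mono conjI)
    fix i
    have "1 + p * (exp (- s * a i) - 1) \<le> exp (p * (exp (- s * a i) - 1))"
      by (rule exp_ge_add_one_self)
    then show "p * exp (- s * a i) + (1 - p) \<le> exp (p * (exp (- s * a i) - 1))"
      by (simp add: algebra_simps)
  qed (use p in auto)
  also have "\<dots> = exp (s * t + (\<Sum>i\<in>I. p * (exp (- s * a i) - 1)))"
    by (simp add: exp_sum[OF fin] exp_add)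
  finally show ?thesis .
qed

section \<open>Large variance: a linear tilt\<close>

lemma cube_tail_large_variance:
  assumes fin: "finite I" and p: "0 < p" "p \<le> 1 / 10 ^ 6"
    and a: "\<And>i. i \<in> I \<Longrightarrow> 0 \<le> a i \<and> a i \<le> A" and A: "0 < A"
    and var: "A\<^sup>2 \<le> 10 ^ 4 * (p * (\<Sum>i\<in>I. (a i)\<^sup>2))"
  shows "p \<le> cube_tail I (\<lambda>_. p) a (p * sum a I)"
proof -
  define W where "W = (\<Sum>i\<in>I. (a i)\<^sup>2)"
  define d where "d = sqrt (p * W)"
  \<comment> \<open>With this scale \<open>k * W = d\<close>, so the mean moves by (1 - p) d, about
    one standard deviation, while the cost, the sum of the x_i^2 divided by \<open>p\<close>, is
    exactly 1.\<close>
  define k where "k = p / d"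
  define x where "x = (\<lambda>i. k * a i)"
  define q where "q = (\<lambda>i. p + (1 - p) * x i)"
  have p1: "p < 1" using p by simp
  have "0 < 10 ^ 4 * (p * W)"
    unfolding W_def by (rule less_le_trans[OF _ var]) (use A in simp)
  then have pW: "0 < p * W" by (simp add: mult.commute)
  have d0: "0 < d" and d2: "d\<^sup>2 = p * W" using pW by (auto simp: d_def)
  have k0: "0 < k" using p d0 by (simp add: k_def)
  have kW: "k * W = d" using p d0 d2 by (simp add: k_def field_simps power2_eq_square)
  have kd: "k * d = p" using d0 by (simp add: k_def)
  have "A\<^sup>2 \<le> (100 * d)\<^sup>2" using var d2 by (simp add: W_def power_mult_distrib)
  then have Ad: "A \<le> 100 * d" by (rule power2_le_imp_le) (use d0 in simp)
  \<comment> \<open>The variance hypothesis, in the form \<open>A \<le> 100 * d\<close>, keeps every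
    tilt below \<open>100 * p\<close>, hence below 1.\<close>
  have x: "0 \<le> x i \<and> x i \<le> 1" if "i \<in> I" for i
  proof -
    have "k * a i \<le> k * (100 * d)" using a[OF that] Ad k0 by (intro mult_left_mono) auto
    also have "\<dots> = 100 * p" using kd by simp
    finally show ?thesis using a[OF that] k0 p by (simp add: x_def)
  qed
  have q: "0 \<le> q i \<and> q i \<le> 1" if "i \<in> I" for i
  proof -
    have "(1 - p) * x i \<le> 1 - p" "0 \<le> (1 - p) * x i"
      using x[OF that] p1 by (simp_all add: mult_left_le)
    then show ?thesis using p unfolding q_def by linarith
  qed
  have "(\<Sum>i\<in>I. q i * a i) = p * sum a I + (1 - p) * (k * W)"
    by (simp add: q_def x_def W_def sum_distrib_left sum.distrib[symmetric] algebra_simps power2_eq_square)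
  then have mean: "9 / 10 * d \<le> (\<Sum>i\<in>I. q i * a i) - p * sum a I"
    using p d0 by (simp add: kW)
  have "(\<Sum>i\<in>I. (a i)\<^sup>2 * (q i * (1 - q i))) \<le> (\<Sum>i\<in>I. (p + k * A) * (a i)\<^sup>2)"
  proof (rule sum_mono)
    fix i assume i: "i \<in> I"
    have "q i * (1 - q i) \<le> q i" using q[OF i] by (simp add: mult_left_le)
    also have "\<dots> \<le> p + x i" using x[OF i] p by (simp add: q_def mult_left_le_one_le)
    also have "\<dots> \<le> p + k * A" using a[OF i] k0 by (simp add: x_def)
    finally show "(a i)\<^sup>2 * (q i * (1 - q i)) \<le> (p + k * A) * (a i)\<^sup>2"
      by (subst mult.commute) (intro mult_right_mono, auto)
  qed
  also have "\<dots> = (p + k * A) * W" by (simp add: W_def sum_distrib_left)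
  also have "\<dots> = d\<^sup>2 + A * d" using d2 kW by (simp add: algebra_simps)
  also have "\<dots> \<le> 101 * d\<^sup>2" using Ad d0 by (simp add: power2_eq_square)
  finally have V: "(\<Sum>i\<in>I. (a i)\<^sup>2 * (q i * (1 - q i))) \<le> 101 * d\<^sup>2" .
  have "(9 / 10 * d)\<^sup>2 / ((9 / 10 * d)\<^sup>2 + 101 * d\<^sup>2) \<le> cube_tail I q a (p * sum a I)"
    using d0 by (intro cube_tail_second_moment[OF fin q _ mean V]) auto
  also have "(9 / 10 * d)\<^sup>2 / ((9 / 10 * d)\<^sup>2 + 101 * d\<^sup>2) = 81 / 10181"
    using d0 by (simp add: power2_eq_square field_simps)
  finally have Q: "(81 / 10181)\<^sup>2 \<le> (cube_tail I q a (p * sum a I))\<^sup>2"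
    by (intro power_mono) auto
  have "(\<Sum>i\<in>I. (x i)\<^sup>2) / p = k\<^sup>2 * W / p"
    by (simp add: x_def W_def power_mult_distrib sum_distrib_left)
  also have "\<dots> = 1"
    using kW kd p by (simp add: power2_eq_square mult.assoc)
  finally have xp: "(\<Sum>i\<in>I. (x i)\<^sup>2) / p = 1" .
  have "exp 1 \<le> (3::real)" by (rule exp_le)
  then have "1 / 3 \<le> exp (- 1 :: real)" by (simp add: exp_minus field_simps)
  with Q have "(81 / 10181)\<^sup>2 * (1 / 3) \<le> (cube_tail I q a (p * sum a I))\<^sup>2 * exp (- 1)"
    by (intro mult_mono) auto
  also have "\<dots> \<le> cube_tail I (\<lambda>_. p) a (p * sum a I)"
    using cube_tail_change_measure[OF fin p(1) p1, of x a "p * sum a I"] x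
    by (simp add: xp q_def)
  \<comment> \<open>The constant (81/10181)^2 / 3 is about 2 * 10^-5, which exceeds 10^-6.\<close>
  finally show ?thesis using p by (simp add: power2_eq_square)
qed

section \<open>One dominant weight: truncated tilt against Chernoff\<close>

text \<open>From (1 - y + y^2)(1 + y) = 1 + y^3 \<ge> 1 and 1 + y \<le> exp y.\<close>

lemma exp_minus_le_quadratic:
  fixes y :: real
  assumes "0 \<le> y"
  shows "exp (- y) \<le> 1 - y + y\<^sup>2"
proof -
  have "1 \<le> (1 - y + y\<^sup>2) * (1 + y)"
    using zero_le_power[OF assms, of 3] by (simp add: algebra_simps power2_eq_square power3_eq_cube)
  also have "\<dots> \<le> (1 - y + y\<^sup>2) * exp y"
  proof (rule mult_left_mono)
    have "0 \<le> (y - 1 / 2)\<^sup>2" by simp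
    then show "0 \<le> 1 - y + y\<^sup>2" by (simp add: power2_eq_square algebra_simps)
  qed simp
  finally show ?thesis by (simp add: exp_minus field_simps)
qed

text \<open>Intermediate value theorem in \<open>k\<close>: the sum is continuous, vanishes at 0 and
  reaches \<open>sum a J\<close> once all terms are truncated.\<close>

lemma exists_truncated_tilt:
  fixes a :: "'i \<Rightarrow> real"
  assumes fin: "finite J" and a: "\<And>i. i \<in> J \<Longrightarrow> 0 < a i"
    and T: "0 \<le> T" "T \<le> sum a J"
  obtains k where "0 \<le> k" "(\<Sum>i\<in>J. a i * min 1 (k * a i)) = T"
proof -
  \<comment> \<open>This sum dominates every \<open>1 / a i\<close>, so at \<open>K\<close> each
    minimum is 1; for empty \<open>J\<close> it is 0.\<close>
  define K where "K = (\<Sum>i\<in>J. 1 / a i)"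
  have K: "1 \<le> K * a i" if "i \<in> J" for i
  proof -
    have "1 / a i \<le> K" unfolding K_def using a that fin
      by (intro member_le_sum) (auto intro: less_imp_le)
    then show ?thesis using a[OF that] by (simp add: field_simps)
  qed
  have K0: "0 \<le> K" unfolding K_def using a by (intro sum_nonneg) (auto intro: less_imp_le)
  have "(\<Sum>i\<in>J. a i * min 1 (K * a i)) = sum a J"
    using K by (intro sum.cong) (auto simp: min_def)
  then have "\<exists>k\<ge>0. k \<le> K \<and> (\<Sum>i\<in>J. a i * min 1 (k * a i)) = T"
    using T K0 by (intro IVT') (auto intro!: continuous_intros)
  then show ?thesis using that by auto
qed

text \<open>Here \<open>J\<close> omits a coordinate of weight \<open>A\<close>, and
  \<open>p * sum a J + p * A\<close> is the mean of the full sum. The left side is the loss when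
  that coordinate is 1, the right side the gain when it is 0; both are compared with the same
  exponential.\<close>

lemma cube_tail_small_weights:
  assumes fin: "finite J" and p: "0 < p" "p \<le> 1 / 10 ^ 6" and A: "0 < A"
    and a: "\<And>i. i \<in> J \<Longrightarrow> 0 < a i \<and> a i \<le> A / 20"
    and var: "10 ^ 4 * (p * (\<Sum>i\<in>J. (a i)\<^sup>2)) \<le> A\<^sup>2"
    and total: "A / 4 \<le> sum a J"
  shows "p * (1 - cube_tail J (\<lambda>_. p) a (p * sum a J + p * A - A))
    \<le> (1 - p) * cube_tail J (\<lambda>_. p) a (p * sum a J + p * A)"
proof -
  obtain k where k: "0 \<le> k" and kT: "(\<Sum>i\<in>J. a i * min 1 (k * a i)) = A / 4"
    using exists_truncated_tilt[OF fin, of a "A / 4"] a A total by auto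
  define x where "x = (\<lambda>i. min 1 (k * a i))"
  define q where "q = (\<lambda>i. p + (1 - p) * x i)"
  \<comment> \<open>Then \<open>p * s = 2 * k\<close>, which turns the quadratic Chernoff term p (s
    a_i)^2 into 2 s a_i (k a_i), matching the tilt.\<close>
  define s where "s = 2 * k / p"
  have p1: "p < 1" using p by simp
  have s0: "0 \<le> s" using k p by (simp add: s_def)
  have T: "(\<Sum>i\<in>J. a i * x i) = A / 4" using kT by (simp add: x_def)
  have x: "0 \<le> x i \<and> x i \<le> 1" if "i \<in> J" for i
    using a[OF that] k by (simp add: x_def)
  have q: "0 \<le> q i \<and> q i \<le> 1" if "i \<in> J" for i
  proof -
    have "(1 - p) * x i \<le> 1 - p" "0 \<le> (1 - p) * x i"
      using x[OF that] p1 by (simp_all add: mult_left_le)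
    then show ?thesis using p unfolding q_def by linarith
  qed
  \<comment> \<open>Untruncated coordinates use the quadratic bound. For truncated ones
    \<open>x i = 1\<close>, and exp(-y) - 1 + y \<le> y suffices.\<close>
  have chernoff_term: "p * (exp (- s * a i) - 1 + s * a i) \<le> 2 * s * (a i * x i)" if i: "i \<in> J" for i
  proof -
    have sa: "0 \<le> s * a i" using s0 a[OF i] by simp
    show ?thesis
    proof (cases "k * a i \<le> 1")
      case True
      have "exp (- s * a i) - 1 + s * a i \<le> (s * a i)\<^sup>2"
        using exp_minus_le_quadratic[OF sa] by simp
      then have "p * (exp (- s * a i) - 1 + s * a i) \<le> p * (s * a i)\<^sup>2"
        using p by (intro mult_left_mono) auto
      also have "\<dots> = (p * s) * (s * (a i * a i))" by (simp add: power2_eq_square)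
      also have "\<dots> = 2 * s * (a i * x i)" using True p by (simp add: x_def s_def)
      finally show ?thesis .
    next
      case False
      have "0 \<le> exp (- s * a i) - 1 + s * a i"
        using exp_ge_add_one_self[of "- s * a i"] by simp
      then have "p * (exp (- s * a i) - 1 + s * a i) \<le> 2 * (s * a i)"
        using p sa by (intro mult_mono) auto
      then show ?thesis using False by (simp add: x_def)
    qed
  qed
  have "s * (p * sum a J + p * A - A) + (\<Sum>i\<in>J. p * (exp (- s * a i) - 1))
      = (\<Sum>i\<in>J. p * (exp (- s * a i) - 1 + s * a i)) - s * ((1 - p) * A)"
    by (simp add: algebra_simps sum_distrib_left sum.distrib sum_subtractf)
  also have "\<dots> \<le> (\<Sum>i\<in>J. 2 * s * (a i * x i)) - s * ((1 - p) * A)"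
    using chernoff_term by (intro diff_right_mono sum_mono)
  also have "\<dots> = s * (A / 2 - (1 - p) * A)"
    by (simp only: sum_distrib_left[symmetric] T) (simp add: algebra_simps)
  \<comment> \<open>Of roughly A/2 only A/8 is kept, because \<open>s * A / 8\<close> is exactly the
    exponent \<open>k * A / (4 * p)\<close> that bounds the cost of the tilt below.\<close>
  also have "\<dots> \<le> s * (- (A / 8))"
    using s0 A p by (intro mult_left_mono) (auto simp: algebra_simps)
  also have "\<dots> = - (k * A / (4 * p))" by (simp add: s_def)
  finally have "1 - cube_tail J (\<lambda>_. p) a (p * sum a J + p * A - A) \<le> exp (- (k * A / (4 * p)))"
    by (intro order_trans[OF cube_tail_Chernoff[OF fin _ _ s0]]) (use p in auto)
  then have loss: "p * (1 - cube_tail J (\<lambda>_. p) a (p * sum a J + p * A - A))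
      \<le> p * exp (- (k * A / (4 * p)))"
    using p by (intro mult_left_mono) auto

  have "(\<Sum>i\<in>J. q i * a i) = p * sum a J + (1 - p) * (\<Sum>i\<in>J. a i * x i)"
    by (simp add: q_def sum_distrib_left sum.distrib[symmetric] algebra_simps)
  moreover have "(1 - p) * (A / 4) = A / 4 - p * A / 4" by (simp add: left_diff_distrib)
  moreover have "p * A \<le> A / 1000000" using p A by simp
  ultimately have mean: "A / 5 \<le> (\<Sum>i\<in>J. q i * a i) - (p * sum a J + p * A)"
    using A unfolding T by linarith
  \<comment> \<open>The cap A/20 on the weights controls the variance added by the tilt: the total
    is at most A^2/10^4 + A^2/80, below the squared mean gap (A/5)^2, so the tilted tail is at least
    1/2.\<close>
  have "(\<Sum>i\<in>J. (a i)\<^sup>2 * (q i * (1 - q i))) \<le> (\<Sum>i\<in>J. p * (a i)\<^sup>2 + A / 20 * (a i * x i))"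
  proof (rule sum_mono)
    fix i assume i: "i \<in> J"
    have "q i * (1 - q i) \<le> q i" using q[OF i] by (simp add: mult_left_le)
    also have "\<dots> \<le> p + x i" using x[OF i] p by (simp add: q_def mult_left_le_one_le)
    finally have "(a i)\<^sup>2 * (q i * (1 - q i)) \<le> (a i)\<^sup>2 * (p + x i)"
      by (intro mult_left_mono) auto
    also have "\<dots> = p * (a i)\<^sup>2 + a i * (a i * x i)"
      by (simp add: algebra_simps power2_eq_square)
    also have "\<dots> \<le> p * (a i)\<^sup>2 + A / 20 * (a i * x i)"
      using a[OF i] x[OF i] by (intro add_left_mono mult_right_mono) auto
    finally show "(a i)\<^sup>2 * (q i * (1 - q i)) \<le> p * (a i)\<^sup>2 + A / 20 * (a i * x i)" .
  qed
  also have "\<dots> = p * (\<Sum>i\<in>J. (a i)\<^sup>2) + A / 20 * (A / 4)"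
    by (simp only: sum.distrib sum_distrib_left[symmetric] T)
  also have "\<dots> \<le> (A / 5)\<^sup>2"
  proof -
    have "p * (\<Sum>i\<in>J. (a i)\<^sup>2) \<le> A\<^sup>2 / 10000" using var by simp
    moreover have "A / 20 * (A / 4) = A\<^sup>2 / 80" "(A / 5)\<^sup>2 = A\<^sup>2 / 25"
      by (simp_all add: power2_eq_square)
    ultimately show ?thesis using zero_le_power2[of A] by linarith
  qed
  finally have V: "(\<Sum>i\<in>J. (a i)\<^sup>2 * (q i * (1 - q i))) \<le> (A / 5)\<^sup>2" .
  have "1 / 2 = (A / 5)\<^sup>2 / ((A / 5)\<^sup>2 + (A / 5)\<^sup>2)" using A by simp
  also have "\<dots> \<le> cube_tail J q a (p * sum a J + p * A)"
    using A by (intro cube_tail_second_moment[OF fin q _ mean V]) auto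
  finally have Q: "(1 / 2)\<^sup>2 \<le> (cube_tail J q a (p * sum a J + p * A))\<^sup>2"
    by (intro power_mono) auto
  \<comment> \<open>Since x_i \<le> k a_i, the cost is bounded by \<open>k\<close> times the shift
    A/4 of the mean, truncated or not.\<close>
  have "(\<Sum>i\<in>J. (x i)\<^sup>2) \<le> (\<Sum>i\<in>J. k * (a i * x i))"
  proof (rule sum_mono)
    fix i assume i: "i \<in> J"
    have "x i * x i \<le> (k * a i) * x i"
      using x[OF i] by (intro mult_right_mono) (auto simp: x_def)
    then show "(x i)\<^sup>2 \<le> k * (a i * x i)" by (simp add: power2_eq_square mult.assoc)
  qed
  also have "\<dots> = k * (A / 4)" by (simp add: sum_distrib_left[symmetric] T)
  finally have "(\<Sum>i\<in>J. (x i)\<^sup>2) / p \<le> k * A / (4 * p)"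
    using p by (simp add: field_simps)
  then have "exp (- (k * A / (4 * p))) \<le> exp (- (\<Sum>i\<in>J. (x i)\<^sup>2) / p)" by simp
  with Q have "(1 / 2)\<^sup>2 * exp (- (k * A / (4 * p)))
      \<le> (cube_tail J q a (p * sum a J + p * A))\<^sup>2 * exp (- (\<Sum>i\<in>J. (x i)\<^sup>2) / p)"
    by (intro mult_mono) auto
  also have "\<dots> \<le> cube_tail J (\<lambda>_. p) a (p * sum a J + p * A)"
    unfolding q_def by (rule cube_tail_change_measure[OF fin p(1) p1 x])
  finally have gain: "(1 - p) * ((1 / 2)\<^sup>2 * exp (- (k * A / (4 * p))))
      \<le> (1 - p) * cube_tail J (\<lambda>_. p) a (p * sum a J + p * A)"
    using p1 by (intro mult_left_mono) auto
  have "p * exp (- (k * A / (4 * p))) \<le> ((1 - p) * (1 / 2)\<^sup>2) * exp (- (k * A / (4 * p)))"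
    using p by (intro mult_right_mono) (auto simp: power2_eq_square)
  with loss gain show ?thesis unfolding mult.assoc by (meson order_trans)
qed

section \<open>Two large weights, and the case distinction on the cube\<close>

lemma cube_tail_nonpos:
  assumes "finite I" "t \<le> 0" "\<And>i. i \<in> I \<Longrightarrow> 0 \<le> a i"
  shows "cube_tail I q a t = 1"
proof -
  have "cube_tail I q a t = cube_exp I q (\<lambda>S. 1)"
    unfolding cube_tail_def cube_exp_def
  proof (rule sum.cong, goal_cases)
    case (2 S)
    then have "0 \<le> sum a S" using assms(3) by (intro sum_nonneg) auto
    then show ?case using assms(2) by simp
  qed simp
  then show ?thesis using assms(1) by (simp add: cube_exp_const)
qed

lemma cube_tail_two_large_weights:
  assumes fin: "finite K" and kj: "k \<noteq> j" "k \<notin> K" "j \<notin> K"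
    and p: "0 < p" "p \<le> 1 / 10 ^ 6" and A: "0 < A" "a k = A" "A / 20 \<le> a j" "a j \<le> A"
    and var: "10 ^ 4 * (p * (\<Sum>i\<in>K. (a i)\<^sup>2)) \<le> A\<^sup>2"
  shows "p \<le> cube_tail (insert k (insert j K)) (\<lambda>_. p) a (p * sum a (insert k (insert j K)))"
proof -
  define t where "t = p * sum a (insert k (insert j K))"
  let ?G = "\<lambda>J. cube_tail J (\<lambda>_. p) a"
  have t: "t = p * A + p * a j + p * sum a K"
    using fin kj A by (simp add: t_def algebra_simps)
  have V: "(\<Sum>i\<in>K. (a i)\<^sup>2 * (p * (1 - p))) \<le> A\<^sup>2 / 10 ^ 4"
  proof -
    have "(\<Sum>i\<in>K. (a i)\<^sup>2 * (p * (1 - p))) \<le> (\<Sum>i\<in>K. (a i)\<^sup>2 * p)"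
      using p by (intro sum_mono mult_left_mono) (auto simp: mult_left_le)
    also have "\<dots> = p * (\<Sum>i\<in>K. (a i)\<^sup>2)" by (simp add: sum_distrib_left mult.commute)
    finally show ?thesis using var by simp
  qed
  have pA: "p * A \<le> A / 1000000" using p A by simp
  have paj: "p * a j \<le> p * A" using p A by simp
  \<comment> \<open>Lowering the target by \<open>c\<close> leaves a gap of at least A/20 - 2pA
    \<ge> A/25; Chebyshev then fails with probability at most 625/10^4 = 1/16.\<close>
  have big: "9 / 10 \<le> ?G K (t - c)" if c: "A / 20 \<le> c" for c
  proof -
    have "9 / 10 \<le> 1 - (A\<^sup>2 / 10 ^ 4) / (A / 25)\<^sup>2"
      using A by (simp add: power_divide)
    also have "\<dots> \<le> ?G K (t - c)"
    proof (rule cube_tail_Chebyshev[OF fin _ _ _ V])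
      show "A / 25 \<le> (\<Sum>i\<in>K. p * a i) - (t - c)"
        using pA paj c A(1) unfolding t sum_distrib_left[symmetric] by linarith
    qed (use p A in auto)
    finally show ?thesis .
  qed
  have nn: "0 \<le> ?G J u" for J u using p by (intro cube_tail_nonneg) auto
  have "?G (insert j K) u \<ge> (1 - p) * ?G K u" for u
    using nn p fin kj by (simp add: cube_tail_insert)
  moreover have "?G (insert j K) u \<ge> p * ?G K (u - a j)" for u
    using nn p fin kj by (simp add: cube_tail_insert)
  \<comment> \<open>Only the two disjoint events in which exactly one of the coordinates
    \<open>k\<close>, \<open>j\<close> is 1 are kept.\<close>
  ultimately have "p * ((1 - p) * ?G K (t - A)) + (1 - p) * (p * ?G K (t - a j)) \<le>
      p * ?G (insert j K) (t - A) + (1 - p) * ?G (insert j K) t"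
    using p by (intro add_mono mult_left_mono) auto
  also have "\<dots> = ?G (insert k (insert j K)) t"
    using fin kj A by (simp add: cube_tail_insert)
  finally have "p * ((1 - p) * (?G K (t - A) + ?G K (t - a j))) \<le> ?G (insert k (insert j K)) t"
    by (simp add: algebra_simps)
  moreover have "p * 1 \<le> p * ((1 - p) * (?G K (t - A) + ?G K (t - a j)))"
  proof (rule mult_left_mono)
    have "1 \<le> (9 / 10) * (9 / 10 + 9 / 10 :: real)" by simp
    also have "\<dots> \<le> (1 - p) * (?G K (t - A) + ?G K (t - a j))"
      using p A big[of A] big[of "a j"] by (intro mult_mono add_mono) auto
    finally show "1 \<le> (1 - p) * (?G K (t - A) + ?G K (t - a j))" .
  qed (use p in simp)
  ultimately show ?thesis by (simp add: t_def)
qed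

text \<open>The claim is homogeneous in the weights, so no normalisation is imposed. The cases
  compare the largest weight \<open>A\<close> with the standard deviation, with the mean
  \<open>t\<close>, and with the other weights.\<close>

lemma cube_tail_at_mean:
  assumes fin: "finite I" "I \<noteq> {}" and p: "0 < p" "p \<le> 1 / 10 ^ 6"
    and a: "\<And>i. i \<in> I \<Longrightarrow> 0 < a i"
  shows "p \<le> cube_tail I (\<lambda>_. p) a (p * sum a I)"
proof -
  define t where "t = p * sum a I"
  let ?G = "\<lambda>J. cube_tail J (\<lambda>_. p) a"
  have "Max (a ` I) \<in> a ` I" using fin by (intro Max_in) auto
  then obtain k where k: "k \<in> I" "a k = Max (a ` I)" by auto
  define A where "A = a k"
  have A: "0 < A" using a[OF k(1)] by (simp add: A_def)
  have aA: "a i \<le> A" if "i \<in> I" for i using k fin that by (simp add: A_def)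
  define J where "J = I - {k}"
  have J: "finite J" "k \<notin> J" "I = insert k J" using fin k by (auto simp: J_def)
  have split: "?G I t = p * ?G J (t - A) + (1 - p) * ?G J t"
    using cube_tail_insert[OF J(1,2), of "\<lambda>_. p" a t] by (simp add: J(3) A_def)
  have tJ: "t = p * sum a J + p * A" using J by (simp add: t_def A_def algebra_simps)
  have nn: "0 \<le> ?G L u" for L u using p by (intro cube_tail_nonneg) auto
  consider (large_variance) "A\<^sup>2 \<le> 10 ^ 4 * (p * (\<Sum>i\<in>I. (a i)\<^sup>2))"
    | (dominant) "t \<le> A"
    | (two) j where "10 ^ 4 * (p * (\<Sum>i\<in>I. (a i)\<^sup>2)) \<le> A\<^sup>2" "j \<in> J" "A / 20 \<le> a j"
    | (one) "10 ^ 4 * (p * (\<Sum>i\<in>I. (a i)\<^sup>2)) \<le> A\<^sup>2" "A < t" "\<And>j. j \<in> J \<Longrightarrow> a j \<le> A / 20"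
    by (meson linear not_le)
  then have "p \<le> ?G I t"
  proof cases
    case large_variance
    then show ?thesis unfolding t_def
      using fin p a aA A by (intro cube_tail_large_variance[of I p a A]) (auto intro: less_imp_le)
  next
    \<comment> \<open>The coordinate \<open>k\<close> alone reaches the mean, so its being 1
      suffices.\<close>
    case dominant
    then have "?G J (t - A) = 1"
      using J a by (intro cube_tail_nonpos) (auto intro: less_imp_le)
    then show ?thesis using split nn[of J t] p by simp
  next
    case two
    define K where "K = J - {j}"
    have K: "finite K" "k \<noteq> j" "k \<notin> K" "j \<notin> K" "I = insert k (insert j K)" "K \<subseteq> I"
      using J two by (auto simp: K_def)
    have "10 ^ 4 * (p * (\<Sum>i\<in>K. (a i)\<^sup>2)) \<le> 10 ^ 4 * (p * (\<Sum>i\<in>I. (a i)\<^sup>2))"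
      using p K fin by (intro mult_left_mono sum_mono2) auto
    with two have "10 ^ 4 * (p * (\<Sum>i\<in>K. (a i)\<^sup>2)) \<le> A\<^sup>2" by linarith
    then show ?thesis unfolding t_def K(5)
      using K two p A aA J by (intro cube_tail_two_large_weights[of K k j p A]) (auto simp: A_def)
  next
    case one
    have "10 ^ 4 * (p * (\<Sum>i\<in>J. (a i)\<^sup>2)) \<le> 10 ^ 4 * (p * (\<Sum>i\<in>I. (a i)\<^sup>2))"
      using p J fin by (intro mult_left_mono sum_mono2) auto
    with one have var: "10 ^ 4 * (p * (\<Sum>i\<in>J. (a i)\<^sup>2)) \<le> A\<^sup>2" by linarith
    \<comment> \<open>Otherwise the mean would be at most 2A/10^6, contrary to \<open>A < t\<close>;
      the tilt needs this much total weight to move the mean by A/4.\<close>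
    have "A / 4 \<le> sum a J"
    proof (rule ccontr)
      assume "\<not> A / 4 \<le> sum a J"
      then have "p * (sum a J + A) \<le> (1 / 10 ^ 6) * (2 * A)"
        using p A a J by (intro mult_mono add_nonneg_nonneg sum_nonneg) (auto intro: less_imp_le)
      then show False using one(2) A by (simp add: tJ algebra_simps)
    qed
    with var one J a p A have "p * (1 - ?G J (t - A)) \<le> (1 - p) * ?G J t"
      unfolding tJ by (intro cube_tail_small_weights) auto
    then show ?thesis unfolding split by (simp add: algebra_simps)
  qed
  then show ?thesis by (simp add: t_def)
qed

section \<open>From random variables to the cube\<close>

text \<open>The sum depends only on the set of coordinates equal to 1. The events \<open>B S\<close>
  that this set is \<open>S\<close> are disjoint, and independence gives each of them the cube
  weight of \<open>S\<close>.\<close>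

lemma (in prob_space) prob_weighted_sum_ge:
  fixes v :: "'i \<Rightarrow> 'a \<Rightarrow> real"
  assumes fin: "finite I" "I \<noteq> {}"
    and v01: "\<And>i \<omega>. i \<in> I \<Longrightarrow> \<omega> \<in> space M \<Longrightarrow> v i \<omega> \<in> {0, 1}"
    and one: "\<And>i. i \<in> I \<Longrightarrow> prob {\<omega> \<in> space M. v i \<omega> = 1} = p"
    and zero: "\<And>i. i \<in> I \<Longrightarrow> prob {\<omega> \<in> space M. v i \<omega> = 0} = 1 - p"
    and ind: "indep_vars (\<lambda>_. borel) v I"
  shows "prob {\<omega> \<in> space M. t \<le> (\<Sum>i\<in>I. w i * v i \<omega>)} = cube_tail I (\<lambda>_. p) w t"
proof -
  define B where "B S = (\<Inter>i\<in>I. v i -` {of_bool (i \<in> S)} \<inter> space M)" for S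
  define F where "F = {S \<in> Pow I. t \<le> sum w S}"
  have v: "random_variable borel (v i)" if "i \<in> I" for i
    using ind that by (simp add: indep_vars_def)
  have B_iff: "\<omega> \<in> B S \<longleftrightarrow> \<omega> \<in> space M \<and> S = {i \<in> I. v i \<omega> = 1}" if "S \<subseteq> I" for S \<omega>
    using that fin v01 by (fastforce simp: B_def split: if_splits)
  have sum_v: "(\<Sum>i\<in>I. w i * v i \<omega>) = sum w {i \<in> I. v i \<omega> = 1}" if "\<omega> \<in> space M" for \<omega>
  proof -
    have "(\<Sum>i\<in>I. w i * v i \<omega>) = (\<Sum>i\<in>I. if v i \<omega> = 1 then w i else 0)"
      using v01 that by (intro sum.cong) force+
    then show ?thesis using fin by (simp add: sum.If_cases Int_def)
  qed
  have "{\<omega> \<in> space M. t \<le> (\<Sum>i\<in>I. w i * v i \<omega>)} = (\<Union>S\<in>F. B S)"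
    by (auto simp: F_def B_iff sum_v)
  also have "prob \<dots> = (\<Sum>S\<in>F. prob (B S))"
  proof (rule finite_measure_finite_Union)
    show "finite F" using fin by (simp add: F_def)
    show "B ` F \<subseteq> events"
      unfolding B_def using fin v by (auto intro!: sets.finite_INT measurable_sets)
    show "disjoint_family_on B F"
      by (auto simp: disjoint_family_on_def F_def B_iff)
  qed
  also have "\<dots> = (\<Sum>S\<in>F. (\<Prod>i\<in>S. p) * (\<Prod>i\<in>I - S. 1 - p))"
  proof (rule sum.cong, goal_cases)
    case (2 S)
    then have S: "S \<subseteq> I" by (simp add: F_def)
    have "prob (B S) = (\<Prod>i\<in>I. prob (v i -` {of_bool (i \<in> S)} \<inter> space M))"
      unfolding B_def using ind fin by (intro indep_varsD_finite) auto
    also have "\<dots> = (\<Prod>i\<in>I. if i \<in> S then p else 1 - p)"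
    proof (rule prod.cong, goal_cases)
      case (2 i)
      have "v i -` {c} \<inter> space M = {\<omega> \<in> space M. v i \<omega> = c}" for c by auto
      then show ?case using one[OF 2] zero[OF 2] by simp
    qed simp
    also have "\<dots> = (\<Prod>i\<in>S. p) * (\<Prod>i\<in>I - S. 1 - p)"
      using fin S by (simp add: prod.If_cases Int_absorb1 Diff_eq Compl_eq)
    finally show ?case .
  qed simp
  also have "\<dots> = cube_tail I (\<lambda>_. p) w t"
    unfolding cube_tail_def cube_exp_def F_def using fin
    by (intro sum.mono_neutral_cong_left) auto
  finally show ?thesis .
qed

theorem mainTheorem2:
  fixes p :: real and m :: nat and w :: "nat \<Rightarrow> real"
    and M :: "'a measure" and v :: "nat \<Rightarrow> 'a \<Rightarrow> real"
  assumes "0 \<le> p" and "p \<le> 1 / 10 ^ 46"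
    and "m > 0"
    and "\<And>i. i \<in> {1..m} \<Longrightarrow> w i > 0"
    and "(\<Sum>i=1..m. w i) = 1"
    and "prob_space M"
    and "\<And>i \<omega>. i \<in> {1..m} \<Longrightarrow> \<omega> \<in> space M \<Longrightarrow> v i \<omega> \<in> {0, 1}"
    and "\<And>i. i \<in> {1..m} \<Longrightarrow> prob_space.bernoulli_rv M p (v i)"
    and "prob_space.indep_vars M (\<lambda>_. borel) v {1..m}"
  shows "measure M {\<omega> \<in> space M. (\<Sum>i=1..m. w i * v i \<omega>) \<ge> p} \<ge> p"
proof (cases "p = 0")
  case True
  then show ?thesis by simp
next
  case False
  interpret prob_space M by fact
  \<comment> \<open>Positivity matters because the tilts have cost proportional to
    \<open>1 / p\<close>; the bound relaxes to the one under which the cube estimate is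
    proved.\<close>
  have p: "0 < p" "p \<le> 1 / 10 ^ 6"
    using assms(1,2) False by auto
  have "prob {\<omega> \<in> space M. p \<le> (\<Sum>i=1..m. w i * v i \<omega>)} = cube_tail {1..m} (\<lambda>_. p) w p"
    using assms(3,7,8,9) by (intro prob_weighted_sum_ge) (auto simp: bernoulli_rv_def)
  \<comment> \<open>As the weights sum to 1, the mean \<open>p * sum w {1..m}\<close> is the
    threshold \<open>p\<close>.\<close>
  moreover have "p \<le> cube_tail {1..m} (\<lambda>_. p) w (p * sum w {1..m})"
    using assms(3,4) p by (intro cube_tail_at_mean) auto
  ultimately show ?thesis using assms(5) by simp
qed

end
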